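(* Let $K$ be an algebraically closed field and let $S=\langle n_1,n_2,n_3,n_4\rangle$ be a $4$-generated pseudo-symmetric numerical semigroup with $n_1<n_2<n_3<n_4$, with associated integer parameters $\alpha_1,\alpha_2,\alpha_3,\alpha_4,\alpha_{21}$ (see context). Assume $\alpha_2>\alpha_{21}+1$ and $\alpha_4=2$, and let $k$ be the smallest positive integer such that $$k(\alpha_2+1)<(k-1)\alpha_1+(k+1)\alpha_{21}+\alpha_3 .$$ If $k=1$, then the local ring $R_S=K[[t^{n_1},t^{n_2},t^{n_3},t^{n_4}]]$ has a non-decreasing Hilbert function, i.e. $H_{R_S}(n)\ge H_{R_S}(n-1)$ for all $n\ge 1$.
   Context: Semigroup. For positive integers $n_1,\dots,n_4$ with $\gcd(n_1,\dots,n_4)=1$, $S=\langle n_1,n_2,n_3,n_4\rangle=\{\sum u_in_i : u_i\in\mathbb{N}\}$. $S$ is pseudo-symmetric if its Frobenius number $F$ (the largest integer not in $S$) is even and $F-x\in S$ for every integer $x\notin S$ with $x\neq F/2$. "4-generated" means $n_1,\dots,n_4$ minimally generate $S$. Parameters. By a theorem of Komeda, which is assumed as the standing description of these semigroups, the $4$-generated pseudo-symmetric semigroup $S$ is given by integers $\alpha_i>1$ ($1\le i\le 4$) and $\alpha_{21}$ with $0<\alpha_{21}<\alpha_1-1$ such that $n_1=\alpha_2\alpha_3(\alpha_4-1)+1$, $n_2=\alpha_{21}\alpha_3\alpha_4+(\alpha_1-\alpha_{21}-1)(\alpha_3-1)+\alpha_3$, $n_3=\alpha_1\alpha_4+(\alpha_1-\alpha_{21}-1)(\alpha_2-1)(\alpha_4-1)-\alpha_4+1$,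 $n_4=\alpha_1\alpha_2(\alpha_3-1)+\alpha_{21}(\alpha_2-1)+\alpha_2$. Toric ideal. $I_S$ is the kernel of the $K$-algebra map $A=K[X_1,X_2,X_3,X_4]\to K[t]$, $X_i\mapsto t^{n_i}$. By the same known theorem, $I_S$ is generated by $X_1^{\alpha_1}-X_3X_4^{\alpha_4-1}$, $X_2^{\alpha_2}-X_1^{\alpha_{21}}X_4$, $X_3^{\alpha_3}-X_1^{\alpha_1-\alpha_{21}-1}X_2$, $X_4^{\alpha_4}-X_1X_2^{\alpha_2-1}X_3^{\alpha_3-1}$, $X_1^{\alpha_{21}+1}X_3^{\alpha_3-1}-X_2X_4^{\alpha_4-1}$. Hilbert function. Let $\mathfrak{m}=\langle t^{n_1},\dots,t^{n_4}\rangle$ be the maximal ideal of $R_S$. The Hilbert function is $H_{R_S}(n)=\dim_{R_S/\mathfrak{m}}(\mathfrak{m}^n/\mathfrak{m}^{n+1})$ for $n\ge 0$. The associated graded ring $\bigoplus_{i\ge0}\mathfrak{m}^i/\mathfrak{m}^{i+1}$ is isomorphic to $A/I_S^*$, where $I_S^*=\langle f^* : f\in I_S\rangle$ and $f^*$ is the homogeneous summand of $f$ of least degree. *)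

theory Defs
  imports
    "HOL-Algebra.Algebra"
    "HOL-Computational_Algebra.Computational_Algebra"
    "Jordan_Normal_Form.Missing_VectorSpace"
begin

section \<open>Numerical semigroups\<close>

text \<open>Semigroups are sets of integers, since both the Frobenius number (which is -1 for the full
  semigroup) and pseudo-symmetry speak about all integers outside the semigroup.\<close>

definition generated_semigroup :: "nat set \<Rightarrow> int set" where
  "generated_semigroup A = {int (\<Sum>a\<in>A. u a * a) | u :: nat \<Rightarrow> nat. True}"

definition minimally_generating :: "nat set \<Rightarrow> bool" where
  "minimally_generating A \<longleftrightarrow> (\<forall>B. B \<subset> A \<longrightarrow> generated_semigroup B \<noteq> generated_semigroup A)"

definition frobenius_number :: "int set \<Rightarrow> int" where
  "frobenius_number S = (GREATEST x. x \<notin> S)"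

definition pseudo_symmetric :: "int set \<Rightarrow> bool" where
  "pseudo_symmetric S \<longleftrightarrow> even (frobenius_number S) \<and>
     (\<forall>x. x \<notin> S \<and> x \<noteq> frobenius_number S div 2 \<longrightarrow> frobenius_number S - x \<in> S)"


section \<open>The complete semigroup ring\<close>

text \<open>For a finite set \<open>A\<close> of positive integers, \<open>K[[t\<^sup>a : a \<in> A]]\<close> consists of the power
  series \<open>\<Sum>\<^sub>u c\<^sub>u \<Prod>\<^sub>a (t\<^sup>a)\<^bsup>u(a)\<^esup>\<close> in the elements \<open>t\<^sup>a\<close>, where \<open>u\<close> ranges over all exponent
  vectors and \<open>c\<close> is an arbitrary family of coefficients. Only finitely many \<open>u\<close> contribute to
  a given power of \<open>t\<close>.\<close>

definition exponent_vectors :: "nat set \<Rightarrow> nat \<Rightarrow> (nat \<Rightarrow> nat) set" where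
  "exponent_vectors A m = {u \<in> A \<rightarrow>\<^sub>E UNIV. (\<Sum>a\<in>A. u a * a) = m}"

definition semigroup_ring :: "nat set \<Rightarrow> ('k::field) fps ring" where
  "semigroup_ring A =
     \<lparr>carrier = {Abs_fps (\<lambda>m. \<Sum>u\<in>exponent_vectors A m. c u) | c. True},
      monoid.mult = (*), one = 1, ring.zero = 0, ring.add = (+)\<rparr>"

definition semigroup_ring_max_ideal :: "nat set \<Rightarrow> ('k::field) fps set" where
  "semigroup_ring_max_ideal A = Idl\<^bsub>semigroup_ring A\<^esub> ((\<lambda>a. fps_X ^ a) ` A)"


section \<open>The Hilbert function of a local ring\<close>

abbreviation ideal_power :: "('a, 'b) ring_scheme \<Rightarrow> 'a set \<Rightarrow> nat \<Rightarrow> 'a set" where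
  "ideal_power R I n \<equiv> I [^]\<^bsub>ideals_set R\<^esub> n"

text \<open>The quotient of \<open>M\<^sup>n\<close> by \<open>M\<^bsup>n+1\<^esup>\<close> as a module over \<open>R Quot M\<close>. Its elements are cosets of
  \<open>M\<^bsup>n+1\<^esup>\<close>; the product of \<open>M +> r\<close> with \<open>M\<^bsup>n+1\<^esup> +> x\<close> is \<open>M\<^bsup>n+1\<^esup> +> r \<otimes> x\<close>, which is well defined
  because \<open>x \<in> M\<^sup>n\<close>. The record fields
  \<open>mult\<close> and \<open>one\<close> have no meaning for a module.\<close>

definition graded_piece ::
  "('a, 'b) ring_scheme \<Rightarrow> 'a set \<Rightarrow> nat \<Rightarrow> ('a set, 'a set) module" where
  "graded_piece R M n =
     \<lparr>carrier = (\<lambda>x. ideal_power R M (n + 1) +>\<^bsub>R\<^esub> x) ` ideal_power R M n,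
      monoid.mult = undefined, one = undefined,
      ring.zero = ideal_power R M (n + 1), ring.add = set_add R,
      module.smult = rcoset_mult R (ideal_power R M (n + 1))\<rparr>"

definition hilbert_function :: "('a, 'b) ring_scheme \<Rightarrow> 'a set \<Rightarrow> nat \<Rightarrow> nat" where
  "hilbert_function R M n = vectorspace.dim (R Quot M) (graded_piece R M n)"

end

theory Submission
  imports Defs "HOL-Number_Theory.Cong"
begin

text \<open>Let \<open>M\<close> be the maximal ideal. The power \<open>M\<^sup>n\<close> consists of all power series supported on the
  semigroup elements of order at least \<open>n\<close>, where the order of an element is the largest length of
  a factorization into generators. Hence the Hilbert function at \<open>n\<close> counts the semigroup elements
  of order exactly \<open>n\<close>.

  Write \<open>\<alpha>\<^sub>1 = p + d + 1\<close>, \<open>\<alpha>\<^sub>2 = b + 1\<close>, \<open>\<alpha>\<^sub>3 = c + 1\<close>, \<open>\<alpha>\<^bsub>21\<^esub> = d\<close>. For \<open>k = 1\<close> the ideal of the tangent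
  cone has leading monomials \<open>X\<^sub>3X\<^sub>4\<close>, \<open>X\<^sub>1\<^sup>dX\<^sub>4\<close>, \<open>X\<^sub>3\<^bsup>c+1\<^esup>\<close>, \<open>X\<^sub>4\<^sup>2\<close>, \<open>X\<^sub>2X\<^sub>4\<close>, \<open>X\<^sub>2\<^bsup>b+1\<^esup>X\<^sub>3\<close>, \<open>X\<^sub>2\<^bsup>b+2\<^esup>\<close>. The standard
  monomials are those with neither \<open>X\<^sub>2\<^bsup>b+1\<^esup>X\<^sub>3\<close>, \<open>X\<^sub>2\<^bsup>b+2\<^esup>\<close> nor \<open>X\<^sub>3\<^bsup>c+1\<^esup>\<close> as a divisor and without \<open>X\<^sub>4\<close>,
  together with \<open>X\<^sub>1\<^sup>iX\<^sub>4\<close> for \<open>i < d\<close>. They represent every semigroup element exactly once, since the \<open>n\<^sub>1\<close>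
  exponent pairs \<open>(j, l)\<close> of \<open>X\<^sub>2, X\<^sub>3\<close> have distinct residues \<open>(j (c + 1) + l) n\<^sub>3\<close> modulo \<open>n\<^sub>1\<close>. Their
  degree is the order, since rewriting the product of a standard monomial and a variable never
  lowers the degree. Multiplication by \<open>X\<^sub>1\<close> then maps the standard monomials of degree \<open>n - 1\<close>
  injectively to those of degree \<open>n\<close>, except for \<open>X\<^sub>1\<^bsup>d-1\<^esup>X\<^sub>4\<close>, which can be sent to \<open>X\<^sub>2\<^bsup>d+1\<^esup>\<close>.\<close>


section \<open>The Hilbert function of a numerical semigroup ring\<close>

text \<open>For \<open>T = order_ideal A n\<close> this turns out to be the \<open>n\<close>-th
  power of the maximal ideal, and for \<open>n = 0\<close> the ring itself.\<close>

definition supported :: "nat set \<Rightarrow> 'k::field fps set" where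
  "supported T = {f. \<forall>m. fps_nth f m \<noteq> 0 \<longrightarrow> m \<in> T}"

text \<open>The elements having a factorization of length at least \<open>n\<close>.\<close>

primrec order_ideal :: "nat set \<Rightarrow> nat \<Rightarrow> nat set" where
  "order_ideal A 0 = {\<Sum>a\<in>A. u a * a | u. True}"
| "order_ideal A (Suc n) = {a + s | a s. a \<in> A \<and> s \<in> order_ideal A n}"

declare order_ideal.simps [simp del]

lemma order_ideal_Suc_iff:
  "m \<in> order_ideal A (Suc n) \<longleftrightarrow> (\<exists>a\<in>A. \<exists>s\<in>order_ideal A n. m = a + s)"
  by (auto simp: order_ideal.simps(2))

section \<open>Arithmetic of series with prescribed support\<close>

lemma supported_add: "f \<in> supported T \<Longrightarrow> g \<in> supported T \<Longrightarrow> f + g \<in> supported T"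
  unfolding supported_def mem_Collect_eq fps_add_nth by (metis add.right_neutral)

lemma supported_uminus: "f \<in> supported T \<Longrightarrow> - f \<in> supported T"
  unfolding supported_def by auto

lemma supported_diff: "f \<in> supported T \<Longrightarrow> g \<in> supported T \<Longrightarrow> f - g \<in> supported T"
  using supported_add[of f T "- g"] supported_uminus by auto

lemma supported_zero [simp]: "0 \<in> supported T"
  unfolding supported_def by auto

lemma supported_mono: "T \<subseteq> U \<Longrightarrow> supported T \<subseteq> supported U"
  unfolding supported_def by auto

lemma supported_mult:
  assumes "f \<in> supported T" "g \<in> supported U" "\<And>s t. s \<in> T \<Longrightarrow> t \<in> U \<Longrightarrow> s + t \<in> W"
  shows "f * g \<in> supported W"
  unfolding supported_def
proof safe
  fix m assume "fps_nth (f * g) m \<noteq> 0"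
  then obtain i where "i \<in> {0..m}" "fps_nth f i * fps_nth g (m - i) \<noteq> 0"
    unfolding fps_mult_nth by (rule sum.not_neutral_contains_not_neutral)
  then show "m \<in> W"
    using assms(1,2) assms(3)[of i "m - i"] unfolding supported_def by auto
qed

lemma supported_X_power: "s \<in> T \<Longrightarrow> fps_X ^ s \<in> supported T"
  unfolding supported_def by (auto split: if_splits)

lemma supported_const: "0 \<in> T \<Longrightarrow> fps_const c \<in> supported T"
  unfolding supported_def by (auto split: if_splits)

section \<open>Lengths of factorizations in the semigroup\<close>

locale positive_generators =
  fixes A :: "nat set"
  assumes finite_gens: "finite A" and zero_notin_gens: "0 \<notin> A"
begin

lemma zero_in_semigroup: "0 \<in> order_ideal A 0"
  unfolding order_ideal.simps(1) by (intro CollectI exI[of _ "\<lambda>_. 0"]) simp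

lemma semigroup_add:
  assumes "s \<in> order_ideal A 0" "t \<in> order_ideal A 0"
  shows "s + t \<in> order_ideal A 0"
proof -
  obtain u v where "s = (\<Sum>a\<in>A. u a * a)" "t = (\<Sum>a\<in>A. v a * a)"
    using assms by (auto simp: order_ideal.simps(1))
  then have "s + t = (\<Sum>a\<in>A. (u a + v a) * a)"
    by (simp add: sum.distrib distrib_right)
  then show ?thesis by (auto simp: order_ideal.simps(1))
qed

lemma gen_in_semigroup:
  assumes "a \<in> A" shows "a \<in> order_ideal A 0"
proof -
  have "(\<Sum>b\<in>A. (if b = a then 1 else 0) * b) = (\<Sum>b\<in>A. if b = a then b else 0)"
    by (rule sum.cong) auto
  also have "\<dots> = a"
    using assms finite_gens by simp
  finally show ?thesis
    unfolding order_ideal.simps(1) by (intro CollectI exI[of _ "\<lambda>b. if b = a then 1 else 0"]) simp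
qed

lemma order_ideal_add_semigroup:
  "s \<in> order_ideal A n \<Longrightarrow> t \<in> order_ideal A 0 \<Longrightarrow> s + t \<in> order_ideal A n"
proof (induction n arbitrary: s)
  case 0
  then show ?case using semigroup_add by blast
next
  case (Suc n)
  then obtain a r where "a \<in> A" "r \<in> order_ideal A n" "s = a + r"
    by (auto simp: order_ideal_Suc_iff)
  then show ?case
    using Suc.IH[of r] Suc.prems(2) unfolding order_ideal_Suc_iff by (metis add.assoc)
qed

lemma order_ideal_subset_semigroup: "order_ideal A n \<subseteq> order_ideal A 0"
proof (induction n)
  case (Suc n)
  show ?case
  proof
    fix s assume "s \<in> order_ideal A (Suc n)"
    then obtain a r where "a \<in> A" "r \<in> order_ideal A n" "s = a + r"
      by (auto simp: order_ideal_Suc_iff)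
    then show "s \<in> order_ideal A 0"
      using semigroup_add[of a r] gen_in_semigroup Suc by auto
  qed
qed simp

lemma order_ideal_Suc_subset: "order_ideal A (Suc n) \<subseteq> order_ideal A n"
proof
  fix s assume "s \<in> order_ideal A (Suc n)"
  then obtain a r where "a \<in> A" "r \<in> order_ideal A n" "s = r + a"
    unfolding order_ideal_Suc_iff by (metis add.commute)
  then show "s \<in> order_ideal A n"
    using order_ideal_add_semigroup[of r n a] gen_in_semigroup by simp
qed

lemma order_ideal_antimono: "m \<le> n \<Longrightarrow> order_ideal A n \<subseteq> order_ideal A m"
  using lift_Suc_antimono_le[of "order_ideal A", OF order_ideal_Suc_subset] .

text \<open>A nonzero sum has a nonzero summand; splitting off one copy of its generator leaves a
  factorization of the remainder.\<close>

lemma semigroup_cases: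
  assumes "s \<in> order_ideal A 0" "s \<noteq> 0" shows "s \<in> order_ideal A 1"
proof -
  obtain u where u: "s = (\<Sum>a\<in>A. u a * a)" using assms by (auto simp: order_ideal.simps(1))
  then obtain a where a: "a \<in> A" "u a * a \<noteq> 0"
    using assms(2) sum.neutral[of A "\<lambda>a. u a * a"] unfolding u by metis
  have "s = u a * a + (\<Sum>b\<in>A - {a}. u b * b)"
    unfolding u by (rule sum.remove[OF finite_gens a(1)])
  also have "(\<Sum>b\<in>A - {a}. u b * b) = (\<Sum>b\<in>A - {a}. (u(a := u a - 1)) b * b)"
    by (rule sum.cong) auto
  also have "u a * a = a + (u(a := u a - 1)) a * a"
    using a(2) by (cases "u a") auto
  also have "a + (u(a := u a - 1)) a * a + (\<Sum>b\<in>A - {a}. (u(a := u a - 1)) b * b)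
      = a + (\<Sum>b\<in>A. (u(a := u a - 1)) b * b)"
    unfolding add.assoc by (subst sum.remove[OF finite_gens a(1)]) (rule refl)
  finally show ?thesis
    unfolding One_nat_def order_ideal_Suc_iff order_ideal.simps(1)
    by (intro bexI[OF _ a(1)] bexI CollectI exI conjI) auto
qed

lemma zero_notin_order_ideal_Suc: "0 \<notin> order_ideal A (Suc n)"
  using zero_notin_gens by (auto simp: order_ideal_Suc_iff)

text \<open>A nonzero \<open>t\<close> contributes at least one generator to a factorization of
  \<open>s + t\<close>.\<close>

lemma order_ideal_add_pos:
  assumes "s \<in> order_ideal A n" "t \<in> order_ideal A 0" "t \<noteq> 0"
  shows "s + t \<in> order_ideal A (Suc n)"
proof -
  obtain a r where "a \<in> A" "r \<in> order_ideal A 0" "t = a + r"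
    using semigroup_cases[OF assms(2,3)] by (auto simp: order_ideal_Suc_iff)
  moreover from this have "s + r \<in> order_ideal A n"
    using assms(1) order_ideal_add_semigroup by blast
  ultimately show ?thesis
    by (auto simp: order_ideal_Suc_iff add.left_commute)
qed

text \<open>An element of order \<open>n + 1\<close> is a generator plus an element of order exactly
  \<open>n\<close>, since a summand of higher order would raise the order of the sum. The induction
  starts from order 0, where only 0 is possible.\<close>

lemma finite_order: "finite (order_ideal A n - order_ideal A (Suc n))"
proof (induction n)
  case 0
  have "order_ideal A 0 - order_ideal A (Suc 0) \<subseteq> {0}"
    using semigroup_cases by auto
  then show ?case using finite_subset by blast
next
  case (Suc n)
  have "order_ideal A (Suc n) - order_ideal A (Suc (Suc n))
      \<subseteq> (\<lambda>(a, s). a + s) ` (A \<times> (order_ideal A n - order_ideal A (Suc n)))"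
    by (fastforce simp: order_ideal_Suc_iff)
  then show ?case using Suc finite_gens finite_subset by blast
qed

section \<open>The semigroup ring as a ring of supported series\<close>

lemma finite_exponent_vectors: "finite (exponent_vectors A m)"
proof (rule finite_subset)
  show "exponent_vectors A m \<subseteq> A \<rightarrow>\<^sub>E {..m}"
  proof
    fix u assume u: "u \<in> exponent_vectors A m"
    have "u a \<le> m" if a: "a \<in> A" for a
    proof -
      have "u a \<le> u a * a" using a zero_notin_gens by (cases a) auto
      also have "\<dots> \<le> (\<Sum>a\<in>A. u a * a)"
        using a finite_gens by (intro member_le_sum) auto
      finally show ?thesis using u unfolding exponent_vectors_def by auto
    qed
    then show "u \<in> A \<rightarrow>\<^sub>E {..m}" using u unfolding exponent_vectors_def by (auto simp: PiE_iff)
  qed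
  show "finite (A \<rightarrow>\<^sub>E {..m})" using finite_gens by (intro finite_PiE) auto
qed

lemma exponent_vectors_nonempty_iff: "exponent_vectors A m \<noteq> {} \<longleftrightarrow> m \<in> order_ideal A 0"
proof
  assume "m \<in> order_ideal A 0"
  then obtain u where "m = (\<Sum>a\<in>A. u a * a)" by (auto simp: order_ideal.simps(1))
  then have "restrict u A \<in> exponent_vectors A m"
    unfolding exponent_vectors_def by auto
  then show "exponent_vectors A m \<noteq> {}" by blast
qed (auto simp: exponent_vectors_def order_ideal.simps(1))

lemma carrier_semigroup_ring: "carrier (semigroup_ring A :: 'k::field fps ring) = supported (order_ideal A 0)"
proof
  show "carrier (semigroup_ring A :: 'k fps ring) \<subseteq> supported (order_ideal A 0)"
    unfolding semigroup_ring_def supported_def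
    using exponent_vectors_nonempty_iff by fastforce
next
  show "supported (order_ideal A 0) \<subseteq> carrier (semigroup_ring A :: 'k fps ring)"
  proof
    fix f :: "'k fps" assume f: "f \<in> supported (order_ideal A 0)"
    \<comment> \<open>One factorization \<open>p m\<close> of each exponent carries the whole
      coefficient of \<open>f\<close>, all others get 0. A vector determines its exponent, so the
      choices do not interfere.\<close>
    define p where "p m = (SOME u. u \<in> exponent_vectors A m)" for m
    define c where "c u = (let m = (\<Sum>a\<in>A. u a * a) in if u = p m then fps_nth f m else 0)" for u
    have "fps_nth f m = (\<Sum>u\<in>exponent_vectors A m. c u)" for m
    proof (cases "m \<in> order_ideal A 0")
      case True
      then have "p m \<in> exponent_vectors A m"
        unfolding p_def using exponent_vectors_nonempty_iff some_in_eq by blast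
      moreover have "(\<Sum>u\<in>exponent_vectors A m. c u)
          = (\<Sum>u\<in>exponent_vectors A m. if u = p m then fps_nth f m else 0)"
        by (rule sum.cong) (auto simp: c_def exponent_vectors_def)
      ultimately show ?thesis using finite_exponent_vectors by simp
    next
      case False
      then show ?thesis
        using f exponent_vectors_nonempty_iff unfolding supported_def by fastforce
    qed
    then have "f = Abs_fps (\<lambda>m. \<Sum>u\<in>exponent_vectors A m. c u)"
      by (simp add: fps_eq_iff)
    then show "f \<in> carrier (semigroup_ring A)"
      unfolding semigroup_ring_def by auto
  qed
qed

lemma semigroup_ring_simps [simp]:
  "monoid.mult (semigroup_ring A) = (*)" "one (semigroup_ring A) = 1"
  "ring.zero (semigroup_ring A) = 0" "ring.add (semigroup_ring A) = (+)"
  unfolding semigroup_ring_def by auto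

lemma cring_semigroup_ring: "cring (semigroup_ring A :: 'k::field fps ring)"
proof (rule cringI)
  show "abelian_group (semigroup_ring A :: 'k fps ring)"
  proof (rule abelian_groupI)
    fix x :: "'k fps" assume "x \<in> carrier (semigroup_ring A)"
    then show "\<exists>y\<in>carrier (semigroup_ring A). y \<oplus>\<^bsub>semigroup_ring A\<^esub> x = \<zero>\<^bsub>semigroup_ring A\<^esub>"
      by (intro bexI[of _ "- x"]) (auto simp: carrier_semigroup_ring supported_uminus)
  qed (auto simp: carrier_semigroup_ring intro: supported_add)
  show "comm_monoid (semigroup_ring A :: 'k fps ring)"
  proof (rule comm_monoidI)
    show "\<one>\<^bsub>semigroup_ring A\<^esub> \<in> carrier (semigroup_ring A :: 'k fps ring)"
      using supported_X_power[OF zero_in_semigroup] by (simp add: carrier_semigroup_ring)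
  next
    fix x y :: "'k fps" assume "x \<in> carrier (semigroup_ring A)" "y \<in> carrier (semigroup_ring A)"
    then show "x \<otimes>\<^bsub>semigroup_ring A\<^esub> y \<in> carrier (semigroup_ring A)"
      using supported_mult[of x _ y] semigroup_add by (auto simp: carrier_semigroup_ring)
  qed auto
qed (simp add: distrib_right)

lemma ideal_supported:
  assumes "T \<subseteq> order_ideal A 0" "\<And>s t. s \<in> order_ideal A 0 \<Longrightarrow> t \<in> T \<Longrightarrow> s + t \<in> T"
  shows "ideal (supported T) (semigroup_ring A :: 'k::field fps ring)"
proof -
  interpret cring "semigroup_ring A :: 'k fps ring" by (rule cring_semigroup_ring)
  show ?thesis
  proof (rule idealI[OF ring_axioms])
    show "subgroup (supported T) (add_monoid (semigroup_ring A :: 'k fps ring))"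
    proof (rule add.subgroupI)
      fix x :: "'k fps" assume x: "x \<in> supported T"
      then have xc: "x \<in> carrier (semigroup_ring A)"
        using supported_mono[OF assms(1)] by (auto simp: carrier_semigroup_ring)
      have "- x = \<ominus>\<^bsub>semigroup_ring A\<^esub> x"
        by (rule minus_equality[symmetric])
           (use xc in \<open>auto simp: carrier_semigroup_ring supported_uminus\<close>)
      then show "\<ominus>\<^bsub>semigroup_ring A\<^esub> x \<in> supported T"
        using supported_uminus[OF x] by simp
    next
      show "supported T \<subseteq> carrier (semigroup_ring A :: 'k fps ring)"
        unfolding carrier_semigroup_ring by (rule supported_mono[OF assms(1)])
      show "supported T \<noteq> ({} :: 'k fps set)"
        using supported_zero by blast
    qed (simp add: supported_add)
  next
    fix f g :: "'k fps" assume fg: "f \<in> supported T" "g \<in> carrier (semigroup_ring A)"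
    show "g \<otimes>\<^bsub>semigroup_ring A\<^esub> f \<in> supported T"
      using supported_mult[of g "order_ideal A 0" f T T] fg assms(2) by (simp add: carrier_semigroup_ring)
    then show "f \<otimes>\<^bsub>semigroup_ring A\<^esub> g \<in> supported T"
      by (simp add: mult.commute)
  qed
qed

section \<open>Powers of the maximal ideal\<close>

lemma ideal_supported_order_ideal:
  "ideal (supported (order_ideal A n)) (semigroup_ring A :: 'k::field fps ring)"
proof (rule ideal_supported[OF order_ideal_subset_semigroup])
  fix s t assume "s \<in> order_ideal A 0" "t \<in> order_ideal A n"
  then show "s + t \<in> order_ideal A n"
    using order_ideal_add_semigroup[of t n s] by (simp add: add.commute)
qed

text \<open>Each exponent \<open>m\<close> is assigned one generator \<open>p m\<close> with
  \<open>m - p m\<close> in \<open>order_ideal A n\<close>; \<open>g a\<close> collects the terms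
  assigned to \<open>a\<close>, shifted down by \<open>a\<close>. As \<open>A\<close> is finite, an
  infinite series becomes a finite sum, as membership in generated ideals and ideal products
  requires.\<close>

lemma supported_order_ideal_decompose:
  fixes f :: "'k::field fps"
  assumes "f \<in> supported (order_ideal A (Suc n))"
  obtains g where "\<And>a. a \<in> A \<Longrightarrow> g a \<in> supported (order_ideal A n)"
    and "f = (\<Sum>a\<in>A. g a * fps_X ^ a)"
proof -
  have "\<forall>m\<in>order_ideal A (Suc n). \<exists>a\<in>A. a \<le> m \<and> m - a \<in> order_ideal A n"
    by (metis add_diff_cancel_left' le_add1 order_ideal_Suc_iff)
  then obtain p where p: "\<And>m. m \<in> order_ideal A (Suc n) \<Longrightarrow> p m \<in> A \<and> p m \<le> m \<and> m - p m \<in> order_ideal A n"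
    by metis
  define g where
    "g a = Abs_fps (\<lambda>m. if m + a \<in> order_ideal A (Suc n) \<and> p (m + a) = a then fps_nth f (m + a) else 0)" for a
  show thesis
  proof (rule that)
    fix a assume "a \<in> A"
    show "g a \<in> supported (order_ideal A n)"
      unfolding supported_def g_def using p by (auto split: if_splits)
         (metis diff_add_inverse2)
  next
    show "f = (\<Sum>a\<in>A. g a * fps_X ^ a)"
    proof (rule fps_ext)
      fix m
      have "fps_nth (\<Sum>a\<in>A. g a * fps_X ^ a) m
          = (\<Sum>a\<in>A. if m \<in> order_ideal A (Suc n) \<and> a = p m then fps_nth f m else 0)"
        unfolding fps_sum_nth
      proof (rule sum.cong)
        fix a assume "a \<in> A"
        show "fps_nth (g a * fps_X ^ a) m
            = (if m \<in> order_ideal A (Suc n) \<and> a = p m then fps_nth f m else 0)"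
          using p[of m] by (cases "m < a") (auto simp: g_def fps_X_power_mult_right_nth)
      qed simp
      also have "\<dots> = fps_nth f m"
        using assms p[of m] finite_gens
        by (cases "m \<in> order_ideal A (Suc n)") (auto simp: supported_def)
      finally show "fps_nth f m = fps_nth (\<Sum>a\<in>A. g a * fps_X ^ a) m" by simp
    qed
  qed
qed

lemma ideal_sum_closed:
  assumes "ideal J (semigroup_ring A :: 'k::field fps ring)" "\<And>i. i \<in> I \<Longrightarrow> g i \<in> J"
  shows "sum g I \<in> J"
proof -
  interpret ideal J "semigroup_ring A :: 'k fps ring" by fact
  show ?thesis
    using assms(2)
  proof (induction I rule: infinite_finite_induct)
    case (insert i I)
    have "g i \<in> J" "sum g I \<in> J" using insert by auto
    from additive_subgroup.a_closed[OF is_additive_subgroup this] show ?case using insert.hyps by simp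
  qed (use additive_subgroup.zero_closed[OF is_additive_subgroup] in auto)
qed

lemma max_ideal_eq: "(semigroup_ring_max_ideal A :: 'k::field fps set) = supported (order_ideal A 1)"
proof
  have "(\<lambda>a. fps_X ^ a) ` A \<subseteq> (supported (order_ideal A 1) :: 'k fps set)"
    using zero_in_semigroup by (force simp: order_ideal_Suc_iff intro!: supported_X_power)
  then show "semigroup_ring_max_ideal A \<subseteq> (supported (order_ideal A 1) :: 'k fps set)"
    unfolding semigroup_ring_max_ideal_def
    using ideal_supported_order_ideal cring.axioms(1)[OF cring_semigroup_ring]
    by (intro ring.genideal_minimal) auto
next
  show "(supported (order_ideal A 1) :: 'k fps set) \<subseteq> semigroup_ring_max_ideal A"
  proof
    fix f :: "'k fps" assume "f \<in> supported (order_ideal A 1)"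
    then obtain g where g: "\<And>a. a \<in> A \<Longrightarrow> g a \<in> supported (order_ideal A 0)"
      and f: "f = (\<Sum>a\<in>A. g a * fps_X ^ a)"
      using supported_order_ideal_decompose[of f 0] by auto
    interpret R: cring "semigroup_ring A :: 'k fps ring" by (rule cring_semigroup_ring)
    have sub: "(\<lambda>a. fps_X ^ a) ` A \<subseteq> carrier (semigroup_ring A :: 'k fps ring)"
      using gen_in_semigroup by (auto simp: carrier_semigroup_ring intro!: supported_X_power)
    have id: "ideal (semigroup_ring_max_ideal A) (semigroup_ring A :: 'k fps ring)"
      unfolding semigroup_ring_max_ideal_def using sub by (rule R.genideal_ideal)
    show "f \<in> semigroup_ring_max_ideal A"
      unfolding f
    proof (rule ideal_sum_closed[OF id])
      fix a assume a: "a \<in> A"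
      then have "fps_X ^ a \<in> (semigroup_ring_max_ideal A :: 'k fps set)"
        unfolding semigroup_ring_max_ideal_def using R.genideal_self[OF sub] by auto
      then show "g a * fps_X ^ a \<in> semigroup_ring_max_ideal A"
        using ideal.I_l_closed[OF id, of "fps_X ^ a" "g a"] g[OF a] by (simp add: carrier_semigroup_ring)
    qed
  qed
qed

text \<open>Orders add up under multiplication, which bounds the product of ideals from above.
  Conversely, the decomposition writes a supported series as a finite sum of products with the
  \<open>fps_X ^ a\<close>.\<close>

lemma ideal_power_eq:
  "ideal_power (semigroup_ring A :: 'k::field fps ring) (semigroup_ring_max_ideal A) n
    = supported (order_ideal A n)"
proof (induction n)
  case 0
  \<comment> \<open>The power with exponent 0 is the unit of \<open>ideals_set\<close>, the whole
    ring.\<close>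
  then show ?case
    by (simp add: nat_pow_def ideals_set_def carrier_semigroup_ring)
next
  case (Suc n)
  interpret R: cring "semigroup_ring A :: 'k fps ring" by (rule cring_semigroup_ring)
  let ?P = "\<lambda>n. supported (order_ideal A n) :: 'k fps set"
  have "ideal_power (semigroup_ring A :: 'k fps ring) (semigroup_ring_max_ideal A) (Suc n)
      = ideal_prod (semigroup_ring A) (?P n) (?P 1)"
    using Suc by (simp add: nat_pow_def ideals_set_def max_ideal_eq)
  also have "\<dots> = ?P (Suc n)"
  proof
    show "ideal_prod (semigroup_ring A) (?P n) (?P 1) \<subseteq> ?P (Suc n)"
    proof
      fix x assume "x \<in> ideal_prod (semigroup_ring A) (?P n) (?P 1)"
      then show "x \<in> ?P (Suc n)"
      proof induction
        case (prod i j)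
        have "s + t \<in> order_ideal A (Suc n)" if "s \<in> order_ideal A n" "t \<in> order_ideal A 1" for s t
          using that order_ideal_add_pos order_ideal_subset_semigroup[of 1]
            zero_notin_order_ideal_Suc[of 0] by (metis One_nat_def subsetD)
        from supported_mult[OF prod this] show ?case by simp
      qed (auto intro: supported_add)
    qed
  next
    show "?P (Suc n) \<subseteq> ideal_prod (semigroup_ring A) (?P n) (?P 1)"
    proof
      fix f assume "f \<in> ?P (Suc n)"
      then obtain g where g: "\<And>a. a \<in> A \<Longrightarrow> g a \<in> supported (order_ideal A n)"
        and f: "f = (\<Sum>a\<in>A. g a * fps_X ^ a)"
        using supported_order_ideal_decompose[of f n] by auto
      have "fps_X ^ a \<in> ?P 1" if "a \<in> A" for a
        using that zero_in_semigroup by (force simp: order_ideal_Suc_iff intro!: supported_X_power)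
      then have "g a * fps_X ^ a \<in> ideal_prod (semigroup_ring A) (?P n) (?P 1)" if "a \<in> A" for a
        using ideal_prod.prod[OF g[OF that], of "fps_X ^ a" "?P 1" "semigroup_ring A"] that by simp
      then show "f \<in> ideal_prod (semigroup_ring A) (?P n) (?P 1)"
        unfolding f using R.ideal_prod_is_ideal ideal_supported_order_ideal
        by (intro ideal_sum_closed) auto
    qed
  qed
  finally show ?case .
qed

section \<open>Cosets modulo powers of the maximal ideal\<close>

definition graded_class :: "nat \<Rightarrow> 'k::field fps \<Rightarrow> 'k fps set" where
  "graded_class n x = {f. f - x \<in> supported (order_ideal A (Suc n))}"

text \<open>For \<open>n = 0\<close> these cosets are the elements of the residue field, so scalars
  and vectors share one notation.\<close>

lemma coset_eq_graded_class:
  "supported (order_ideal A (Suc n)) +>\<^bsub>semigroup_ring A\<^esub> x = graded_class n x"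
proof -
  have "f \<in> supported (order_ideal A (Suc n)) +>\<^bsub>semigroup_ring A\<^esub> x
      \<longleftrightarrow> (\<exists>h\<in>supported (order_ideal A (Suc n)). f = h + x)" for f
    by (auto simp: a_r_coset_def')
  also have "\<dots> f \<longleftrightarrow> f - x \<in> supported (order_ideal A (Suc n))" for f
    by (metis add_diff_cancel_right' diff_add_cancel)
  finally show ?thesis unfolding graded_class_def by blast
qed

lemma graded_class_self: "x \<in> graded_class n x"
  unfolding graded_class_def by simp

lemma graded_class_eq_iff: "graded_class n x = graded_class n y \<longleftrightarrow> x - y \<in> supported (order_ideal A (Suc n))"
proof
  assume "graded_class n x = graded_class n y"
  then show "x - y \<in> supported (order_ideal A (Suc n))"
    using graded_class_self[of x n] unfolding graded_class_def by simp
next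
  assume xy: "x - y \<in> supported (order_ideal A (Suc n))"
  have "f - x \<in> supported (order_ideal A (Suc n)) \<longleftrightarrow> f - y \<in> supported (order_ideal A (Suc n))" for f
    using supported_add[OF _ xy, of "f - x"] supported_diff[OF _ xy, of "f - y"] by auto
  then show "graded_class n x = graded_class n y" unfolding graded_class_def by simp
qed

lemma graded_class_zero: "graded_class n 0 = supported (order_ideal A (Suc n))"
  unfolding graded_class_def by simp

lemma graded_class_add: "set_add (semigroup_ring A) (graded_class n x) (graded_class n y) = graded_class n (x + y)"
proof
  show "set_add (semigroup_ring A) (graded_class n x) (graded_class n y) \<subseteq> graded_class n (x + y)"
  proof
    fix f assume "f \<in> set_add (semigroup_ring A) (graded_class n x) (graded_class n y)"
    then obtain g h where "g \<in> graded_class n x" "h \<in> graded_class n y" "f = g + h"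
      by (auto simp: set_add_def')
    then show "f \<in> graded_class n (x + y)"
      unfolding graded_class_def using supported_add[of "g - x" _ "h - y"] by (simp add: algebra_simps)
  qed
  show "graded_class n (x + y) \<subseteq> set_add (semigroup_ring A) (graded_class n x) (graded_class n y)"
  proof
    fix f assume "f \<in> graded_class n (x + y)"
    then have "f - y \<in> graded_class n x" "f = (f - y) + y"
      unfolding graded_class_def by (auto simp: algebra_simps)
    then show "f \<in> set_add (semigroup_ring A) (graded_class n x) (graded_class n y)"
      using graded_class_self[of y n] unfolding set_add_def' semigroup_ring_simps by blast
  qed
qed

text \<open>\<open>rcoset_mult\<close> is a union of cosets over all pairs of representatives. They
  coincide because \<open>g * h - r * x = (g - r) * x + g * (h - x)\<close>, where both summands are
  supported in order above \<open>n\<close>.\<close>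

lemma graded_class_mult:
  assumes r: "r \<in> supported (order_ideal A 0)" and x: "x \<in> supported (order_ideal A n)"
  shows "rcoset_mult (semigroup_ring A) (supported (order_ideal A (Suc n))) (graded_class 0 r) (graded_class n x)
    = graded_class n (r * x)"
proof -
  have 1: "s + t \<in> order_ideal A (Suc n)" if "s \<in> order_ideal A (Suc 0)" "t \<in> order_ideal A n" for s t
    using that order_ideal_add_pos[of t n s] order_ideal_subset_semigroup[of "Suc 0"]
      zero_notin_order_ideal_Suc[of 0] by (metis add.commute subsetD)
  have 2: "s + t \<in> order_ideal A (Suc n)" if "s \<in> order_ideal A 0" "t \<in> order_ideal A (Suc n)" for s t
    using order_ideal_add_semigroup[OF that(2,1)] by (simp add: add.commute)
  have *: "graded_class n (g * h) = graded_class n (r * x)"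
    if g: "g \<in> graded_class 0 r" and h: "h \<in> graded_class n x" for g h
  proof -
    have "(g - r) * x \<in> supported (order_ideal A (Suc n))"
      using supported_mult[OF _ x 1] g unfolding graded_class_def by blast
    moreover have "g - r \<in> supported (order_ideal A 0)"
      using g supported_mono[OF order_ideal_subset_semigroup] unfolding graded_class_def by blast
    then have "g \<in> supported (order_ideal A 0)"
      using supported_add[OF _ r, of "g - r"] by simp
    then have "g * (h - x) \<in> supported (order_ideal A (Suc n))"
      using supported_mult[OF _ _ 2] h unfolding graded_class_def by blast
    ultimately have "(g - r) * x + g * (h - x) \<in> supported (order_ideal A (Suc n))"
      by (rule supported_add)
    then show ?thesis unfolding graded_class_eq_iff by (simp add: algebra_simps)
  qed
  have "rcoset_mult (semigroup_ring A) (supported (order_ideal A (Suc n))) (graded_class 0 r) (graded_class n x)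
    = (\<Union>g\<in>graded_class 0 r. \<Union>h\<in>graded_class n x. graded_class n (g * h))"
    unfolding rcoset_mult_def coset_eq_graded_class by simp
  also have "\<dots> = (\<Union>g\<in>graded_class 0 r. \<Union>h\<in>graded_class n x. graded_class n (r * x))"
    using * by simp
  also have "\<dots> = graded_class n (r * x)"
    using graded_class_self by blast
  finally show ?thesis .
qed

text \<open>A larger ideal has an element \<open>f\<close> with nonzero constant term. Subtracting
  the other terms, which lie in the maximal ideal, leaves a nonzero constant, hence a unit.\<close>

lemma maximalideal_max_ideal:
  "maximalideal (supported (order_ideal A 1)) (semigroup_ring A :: 'k::field fps ring)"
proof (rule maximalidealI[OF ideal_supported_order_ideal])
  have "1 \<notin> (supported (order_ideal A 1) :: 'k fps set)"
    using zero_notin_order_ideal_Suc[of 0] unfolding supported_def by (auto intro!: exI[of _ 0])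
  moreover have "1 \<in> (supported (order_ideal A 0) :: 'k fps set)"
    using supported_const[OF zero_in_semigroup, of 1] by simp
  ultimately show "carrier (semigroup_ring A :: 'k fps ring) \<noteq> supported (order_ideal A 1)"
    unfolding carrier_semigroup_ring by blast
next
  fix J assume J: "ideal J (semigroup_ring A :: 'k fps ring)" "supported (order_ideal A 1) \<subseteq> J"
    "J \<subseteq> carrier (semigroup_ring A)"
  show "J = supported (order_ideal A 1) \<or> J = carrier (semigroup_ring A)"
  proof (cases "J \<subseteq> supported (order_ideal A 1)")
    case False
    then obtain f where f: "f \<in> J" "f \<notin> supported (order_ideal A 1)" by blast
    define c where "c = fps_nth f 0"
    have fS: "f \<in> supported (order_ideal A 0)" using f(1) J(3) carrier_semigroup_ring by blast
    have diff: "fps_const c - f \<in> supported (order_ideal A 1)"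
      unfolding supported_def
    proof safe
      fix m assume "fps_nth (fps_const c - f) m \<noteq> 0"
      then have "m \<noteq> 0" "fps_nth f m \<noteq> 0" by (auto simp: c_def split: if_splits)
      then show "m \<in> order_ideal A 1" using fS semigroup_cases unfolding supported_def by blast
    qed
    have "c \<noteq> 0"
    proof
      assume "c = 0"
      then have "- f \<in> supported (order_ideal A 1)" using diff by simp
      then show False using f(2) supported_uminus[of "- f"] by simp
    qed
    have "(fps_const c - f) + f \<in> J"
      using additive_subgroup.a_closed[OF ideal.axioms(1)[OF J(1)], of "fps_const c - f" f] J(2) diff f(1)
      by auto
    then have "fps_const (1 / c) \<otimes>\<^bsub>semigroup_ring A\<^esub> fps_const c \<in> J"
      using supported_const[OF zero_in_semigroup]
      by (intro ideal.I_l_closed[OF J(1)]) (auto simp: carrier_semigroup_ring)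
    then have "\<one>\<^bsub>semigroup_ring A\<^esub> \<in> J" using \<open>c \<noteq> 0\<close> by simp
    then show ?thesis using ideal.one_imp_carrier[OF J(1)] by blast
  qed (use J in blast)
qed

section \<open>Monomial bases of the graded pieces\<close>

abbreviation residue_field :: "'k::field fps set ring" where
  "residue_field \<equiv> semigroup_ring A Quot semigroup_ring_max_ideal A"

lemma field_residue_field: "field (residue_field :: 'k::field fps set ring)"
  unfolding max_ideal_eq
  using maximalideal.quotient_is_field[OF maximalideal_max_ideal cring_semigroup_ring] .

lemma residue_field_simps:
  "carrier (residue_field :: 'k::field fps set ring) = graded_class 0 ` supported (order_ideal A 0)"
  "monoid.mult (residue_field :: 'k::field fps set ring) = rcoset_mult (semigroup_ring A) (supported (order_ideal A (Suc 0)))"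
  "one (residue_field :: 'k::field fps set ring) = graded_class 0 1"
  "ring.zero (residue_field :: 'k::field fps set ring) = graded_class 0 0"
  "ring.add (residue_field :: 'k::field fps set ring) = set_add (semigroup_ring A)"
  unfolding max_ideal_eq FactRing_def One_nat_def
  by (auto simp: coset_eq_graded_class carrier_semigroup_ring A_RCOSETS_def' graded_class_zero)

abbreviation graded_part :: "nat \<Rightarrow> ('k::field fps set, 'k fps set) module" where
  "graded_part n \<equiv> graded_piece (semigroup_ring A) (semigroup_ring_max_ideal A) n"

lemma graded_part_simps:
  "carrier (graded_part n :: ('k::field fps set, _) module) = graded_class n ` supported (order_ideal A n)"
  "ring.zero (graded_part n :: ('k::field fps set, _) module) = graded_class n 0"
  "ring.add (graded_part n :: ('k::field fps set, _) module) = set_add (semigroup_ring A)"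
  "module.smult (graded_part n :: ('k::field fps set, _) module)
    = rcoset_mult (semigroup_ring A) (supported (order_ideal A (Suc n)))"
  unfolding graded_piece_def ideal_power_eq Suc_eq_plus1[symmetric] coset_eq_graded_class graded_class_zero
  by auto

lemma vectorspace_graded_part:
  "vectorspace (residue_field :: 'k::field fps set ring) (graded_part n)"
proof (rule vectorspace.intro)
  show "field (residue_field :: 'k fps set ring)" by (rule field_residue_field)
  have mult_closed: "r * x \<in> supported (order_ideal A n)"
    if "r \<in> supported (order_ideal A 0)" "x \<in> supported (order_ideal A n)" for r x :: "'k fps" and n
    using supported_mult[OF that, of "order_ideal A n"] order_ideal_add_semigroup
    by (metis add.commute)
  have one: "1 \<in> (supported (order_ideal A 0) :: 'k fps set)"
    using supported_const[OF zero_in_semigroup, of 1] by simp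
  show "module (residue_field :: 'k fps set ring) (graded_part n)"
  proof (rule module_criteria)
    show "cring (residue_field :: 'k fps set ring)"
      using field_residue_field by (meson field.axioms(1) domain.axioms(1))
    show "\<forall>v\<in>carrier (graded_part n :: ('k fps set, _) module). \<exists>w\<in>carrier (graded_part n).
        v \<oplus>\<^bsub>graded_part n\<^esub> w = \<zero>\<^bsub>graded_part n\<^esub>"
    proof
      fix v :: "'k fps set" assume "v \<in> carrier (graded_part n)"
      then obtain x where x: "x \<in> supported (order_ideal A n)" "v = graded_class n x"
        by (auto simp: graded_part_simps)
      then show "\<exists>w\<in>carrier (graded_part n). v \<oplus>\<^bsub>graded_part n\<^esub> w = \<zero>\<^bsub>graded_part n\<^esub>"
        by (intro bexI[of _ "graded_class n (- x)"])
           (auto simp: graded_part_simps graded_class_add supported_uminus)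
    qed
  qed (auto simp: graded_part_simps residue_field_simps graded_class_add graded_class_mult
      mult_closed supported_add one algebra_simps)
qed

text \<open>Evaluating linear combinations on representatives turns independence and spanning into
  statements about a single series.\<close>

lemma finsum_graded_part:
  fixes r :: "nat \<Rightarrow> 'k::field fps"
  assumes "finite I" "I \<subseteq> order_ideal A n" "\<And>s. s \<in> I \<Longrightarrow> r s \<in> supported (order_ideal A 0)"
  shows "(\<Oplus>\<^bsub>graded_part n\<^esub>s\<in>I. graded_class 0 (r s) \<odot>\<^bsub>graded_part n\<^esub> graded_class n (fps_X ^ s))
    = graded_class n (\<Sum>s\<in>I. r s * fps_X ^ s)"
proof -
  interpret vectorspace "residue_field :: 'k fps set ring" "graded_part n"
    by (rule vectorspace_graded_part)
  have closed: "graded_class 0 (r s) \<odot>\<^bsub>graded_part n\<^esub> graded_class n (fps_X ^ s) \<in> carrier (graded_part n)"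
    if "s \<in> I" for s
    using that assms by (intro smult_closed) (auto simp: graded_part_simps residue_field_simps supported_X_power)
  show ?thesis
    using assms(1) subset_refl
  proof (induction rule: finite_subset_induct')
    case empty
    then show ?case by (simp add: graded_part_simps)
  next
    case (insert s J)
    then have "fps_X ^ s \<in> (supported (order_ideal A n) :: 'k fps set)"
      using assms(2) by (auto intro!: supported_X_power)
    then have "graded_class 0 (r s) \<odot>\<^bsub>graded_part n\<^esub> graded_class n (fps_X ^ s) = graded_class n (r s * fps_X ^ s)"
      using graded_class_mult[of "r s"] assms(3) insert by (simp add: graded_part_simps)
    then show ?case
      using insert closed[of s] closed
      by (subst M.finsum_insert) (auto simp: graded_part_simps(3) graded_class_add simp del: smult_closed)
  qed
qed

text \<open>The classes of \<open>fps_X ^ s\<close> with \<open>s\<close> of order exactly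
  \<open>n\<close> form a basis of the graded piece over the residue field.\<close>

lemma hilbert_function_semigroup_ring:
  "hilbert_function (semigroup_ring A :: 'k::field fps ring) (semigroup_ring_max_ideal A) n
    = card (order_ideal A n - order_ideal A (Suc n))"
proof -
  interpret vectorspace "residue_field :: 'k fps set ring" "graded_part n"
    by (rule vectorspace_graded_part)
  let ?I = "order_ideal A n - order_ideal A (Suc n)"
  let ?e = "\<lambda>s. graded_class n (fps_X ^ s :: 'k fps)"
  have inj: "inj_on ?e ?I"
  proof (rule inj_onI, rule ccontr)
    fix s t assume st: "s \<in> ?I" "t \<in> ?I" "?e s = ?e t" "s \<noteq> t"
    then have "(fps_X ^ s - fps_X ^ t :: 'k fps) \<in> supported (order_ideal A (Suc n))"
      by (simp add: graded_class_eq_iff)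
    moreover have "fps_nth (fps_X ^ s - fps_X ^ t :: 'k fps) s \<noteq> 0" using st(4) by simp
    ultimately show False using st(1) unfolding supported_def by blast
  qed
  have e_carrier: "?e ` ?I \<subseteq> carrier (graded_part n)"
    by (auto simp: graded_part_simps supported_X_power)
  have lincomb_eq: "lincomb a (?e ` ?I) = graded_class n (\<Sum>s\<in>?I. r s * fps_X ^ s)"
    if r: "\<And>s. s \<in> ?I \<Longrightarrow> r s \<in> supported (order_ideal A 0)" "\<And>s. s \<in> ?I \<Longrightarrow> a (?e s) = graded_class 0 (r s)"
    for a r
  proof -
    have closed: "graded_class 0 (r s) \<odot>\<^bsub>graded_part n\<^esub> ?e s \<in> carrier (graded_part n)" if "s \<in> ?I" for s
      using r(1)[OF that] e_carrier that by (intro smult_closed) (auto simp: residue_field_simps(1))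
    have "lincomb a (?e ` ?I) = (\<Oplus>\<^bsub>graded_part n\<^esub>s\<in>?I. a (?e s) \<odot>\<^bsub>graded_part n\<^esub> ?e s)"
      unfolding lincomb_def by (rule M.finsum_reindex[OF _ inj]) (use r(2) closed in auto)
    also have "\<dots> = (\<Oplus>\<^bsub>graded_part n\<^esub>s\<in>?I. graded_class 0 (r s) \<odot>\<^bsub>graded_part n\<^esub> ?e s)"
      by (rule M.finsum_cong') (use r(2) closed in auto)
    also have "\<dots> = graded_class n (\<Sum>s\<in>?I. r s * fps_X ^ s)"
      using finite_order r(1) by (intro finsum_graded_part) auto
    finally show ?thesis .
  qed
  have "lin_indpt (?e ` ?I)"
  proof (rule finite_lin_indpt2)
    fix a :: "'k fps set \<Rightarrow> 'k fps set"
    assume a: "a \<in> ?e ` ?I \<rightarrow> carrier residue_field" "lincomb a (?e ` ?I) = \<zero>\<^bsub>graded_part n\<^esub>"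
    have "\<forall>s\<in>?I. \<exists>r\<in>supported (order_ideal A 0). a (?e s) = graded_class 0 r"
      using a(1) by (auto simp: residue_field_simps(1))
    then obtain r where r: "\<And>s. s \<in> ?I \<Longrightarrow> r s \<in> supported (order_ideal A 0)"
      "\<And>s. s \<in> ?I \<Longrightarrow> a (?e s) = graded_class 0 (r s)" by metis
    have "graded_class n (\<Sum>s\<in>?I. r s * fps_X ^ s) = graded_class n 0"
      using lincomb_eq[of r a, OF r] a(2) by (simp add: graded_part_simps(2))
    then have sum: "(\<Sum>s\<in>?I. r s * fps_X ^ s) \<in> supported (order_ideal A (Suc n))"
      by (simp add: graded_class_eq_iff)
    show "\<forall>v\<in>?e ` ?I. a v = \<zero>\<^bsub>residue_field\<^esub>"
    proof
      fix v assume "v \<in> ?e ` ?I"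
      then obtain t where v: "v = ?e t" and t: "t \<in> order_ideal A n" "t \<notin> order_ideal A (Suc n)"
        by blast
      \<comment> \<open>For \<open>s < t\<close>, the series \<open>r s\<close> has no term at
        \<open>t - s\<close>, since otherwise \<open>t = s + (t - s)\<close> would have order above
        \<open>n\<close>. Only \<open>s = t\<close> contributes, with the constant term of
        \<open>r t\<close>.\<close>
      have "fps_nth (r s * fps_X ^ s) t = (if s = t then fps_nth (r t) 0 else 0)" if s: "s \<in> ?I" for s
      proof (cases "s < t")
        case True
        have "t - s \<notin> order_ideal A 0"
          using order_ideal_add_pos[of s n "t - s"] s t True by auto
        then show ?thesis
          using r(1)[OF s] True unfolding supported_def by (auto simp: fps_X_power_mult_right_nth)
      qed (auto simp: fps_X_power_mult_right_nth)
      then have "fps_nth (\<Sum>s\<in>?I. r s * fps_X ^ s) t = (\<Sum>s\<in>?I. if s = t then fps_nth (r t) 0 else 0)"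
        unfolding fps_sum_nth by (intro sum.cong) auto
      also have "\<dots> = fps_nth (r t) 0"
        using finite_order t by simp
      finally have "fps_nth (\<Sum>s\<in>?I. r s * fps_X ^ s) t = fps_nth (r t) 0" .
      moreover have "fps_nth (\<Sum>s\<in>?I. r s * fps_X ^ s) t = 0"
        using sum t(2) unfolding supported_def by blast
      ultimately have "fps_nth (r t) 0 = 0" by simp
      \<comment> \<open>Without constant term \<open>r t\<close> lies in the maximal ideal, so its
        class is the zero scalar.\<close>
      then have "r t \<in> supported (order_ideal A (Suc 0))"
        using r(1)[of t] t semigroup_cases unfolding supported_def One_nat_def by fastforce
      then show "a v = \<zero>\<^bsub>residue_field\<^esub>"
        unfolding v using r(2)[of t] t by (simp add: residue_field_simps(4) graded_class_eq_iff)
    qed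
  qed (use finite_order e_carrier in auto)
  moreover have "gen_set (?e ` ?I)"
  proof
    show "span (?e ` ?I) \<subseteq> carrier (graded_part n)"
      using span_is_subset2[OF e_carrier] .
    show "carrier (graded_part n) \<subseteq> span (?e ` ?I)"
    proof
      fix v :: "'k fps set" assume "v \<in> carrier (graded_part n)"
      then obtain f where f: "f \<in> supported (order_ideal A n)" "v = graded_class n f"
        by (auto simp: graded_part_simps(1))
      \<comment> \<open>Coefficients are indexed by classes, so \<open>inv_into\<close> recovers the
        exponent \<open>s\<close> from the class of \<open>fps_X ^ s\<close>.\<close>
      define a where "a v = graded_class 0 (fps_const (fps_nth f (inv_into ?I ?e v)))" for v
      have a: "a \<in> ?e ` ?I \<rightarrow> carrier residue_field"
        unfolding a_def using supported_const[OF zero_in_semigroup] by (auto simp: residue_field_simps(1))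
      have "a (?e s) = graded_class 0 (fps_const (fps_nth f s))" if "s \<in> ?I" for s
        unfolding a_def inv_into_f_f[OF inj that] ..
      then have "lincomb a (?e ` ?I) = graded_class n (\<Sum>s\<in>?I. fps_const (fps_nth f s) * fps_X ^ s)"
        using supported_const[OF zero_in_semigroup] by (intro lincomb_eq)
      \<comment> \<open>The terms of \<open>f\<close> missing from the sum have order above
        \<open>n\<close> and vanish in the graded piece.\<close>
      also have "\<dots> = v"
        unfolding f(2) graded_class_eq_iff supported_def
      proof safe
        fix m assume m: "fps_nth ((\<Sum>s\<in>?I. fps_const (fps_nth f s) * fps_X ^ s) - f) m \<noteq> 0"
        have "fps_nth (\<Sum>s\<in>?I. fps_const (fps_nth f s) * fps_X ^ s) m
            = (\<Sum>s\<in>?I. if s = m then fps_nth f m else 0)"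
          unfolding fps_sum_nth by (rule sum.cong) auto
        then have "fps_nth (\<Sum>s\<in>?I. fps_const (fps_nth f s) * fps_X ^ s) m = (if m \<in> ?I then fps_nth f m else 0)"
          using finite_order by simp
        then have "m \<notin> ?I" "fps_nth f m \<noteq> 0" using m by (auto split: if_splits)
        then show "m \<in> order_ideal A (Suc n)" using f(1) unfolding supported_def by blast
      qed
      finally show "v \<in> span (?e ` ?I)"
        unfolding span_def using a finite_order by blast
    qed
  qed
  ultimately have "basis (?e ` ?I)" unfolding basis_def using e_carrier by blast
  then have "dim = card (?e ` ?I)" using finite_order by (intro dim_basis) auto
  then show ?thesis unfolding hilbert_function_def using card_image[OF inj] by simp
qed

end


section \<open>Normal forms of the semigroup elements\<close>

text \<open>The relations \<open>rel1\<close> to \<open>rel5\<close> are Komeda's generators of the toric ideal for \<open>\<alpha>\<^sub>4 = 2\<close>.\<close>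

locale pseudo_symmetric_relations =
  fixes n1 n2 n3 n4 b c d p :: nat
  assumes n1_eq: "n1 = (b + 1) * (c + 1) + 1"
    and rel1: "(d + 1 + p) * n1 = n3 + n4"
    and rel2: "(b + 1) * n2 = d * n1 + n4"
    and rel3: "(c + 1) * n3 = p * n1 + n2"
    and rel4: "2 * n4 = n1 + b * n2 + c * n3"
    and rel5: "(d + 1) * n1 + c * n3 = n2 + n4"
    and gens_pos: "0 < n1" "0 < n2" "0 < n3" "0 < n4"
    and gens_Gcd: "Gcd {n1, n2, n3, n4} = 1"
    and bounds: "0 < c" "c \<le> p" "0 < d" "d < b" "b + 1 < 2 * d + c"
begin

text \<open>The quadruple \<open>(i, j, l, e)\<close> stands for the monomial \<open>X\<^sub>1\<^sup>i X\<^sub>2\<^sup>j X\<^sub>3\<^sup>l X\<^sub>4\<^sup>e\<close>.\<close>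

fun normal_form :: "nat \<times> nat \<times> nat \<times> nat \<Rightarrow> bool" where
  "normal_form (i, j, l, e) \<longleftrightarrow>
    e = 0 \<and> l \<le> c \<and> (j \<le> b \<or> j = b + 1 \<and> l = 0) \<or> e = 1 \<and> j = 0 \<and> l = 0 \<and> i < d"

fun val :: "nat \<times> nat \<times> nat \<times> nat \<Rightarrow> nat" where
  "val (i, j, l, e) = i * n1 + j * n2 + l * n3 + e * n4"

fun total_degree :: "nat \<times> nat \<times> nat \<times> nat \<Rightarrow> nat" where
  "total_degree (i, j, l, e) = i + j + l + e"

section \<open>Reduction of products to normal form\<close>

lemma rel6: "(b + 1) * n2 + n3 = (2 * d + 1 + p) * n1"
  using rel1 rel2 by (simp add: algebra_simps)

text \<open>Rewrites \<open>X2^(b+2)\<close> as \<open>X1^(2d+1) X3^c\<close>. The bound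
  \<open>b + 1 < 2 * d + c\<close>, which is the inequality for \<open>k = 1\<close>, keeps the
  degree from dropping.\<close>

lemma rel7: "(b + 2) * n2 = (2 * d + 1) * n1 + c * n3"
  using rel2 rel5 by (simp add: algebra_simps)

lemma normal_form_cases:
  assumes "normal_form x"
  obtains (main) i j l where "x = (i, j, l, 0)" "l \<le> c" "j \<le> b"
  | (top) i where "x = (i, b + 1, 0, 0)"
  | (exc) i where "x = (i, 0, 0, 1)" "i < d"
  using assms by (cases x) auto

text \<open>The strict inequality is the point of this and the next three lemmas: the product with
  the variable has degree \<open>total_degree x + 1\<close>, and its normal form has at least that
  degree.\<close>

lemma normal_form_add_n1:
  assumes "normal_form x"
  shows "\<exists>y. normal_form y \<and> val y = val x + n1 \<and> total_degree x < total_degree y"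
  using assms
proof (cases rule: normal_form_cases)
  case (main i j l)
  then show ?thesis by (intro exI[of _ "(i + 1, j, l, 0)"]) auto
next
  case (top i)
  then show ?thesis by (intro exI[of _ "(i + 1, b + 1, 0, 0)"]) auto
next
  case (exc i)
  show ?thesis
  proof (cases "i + 1 < d")
    case True
    then show ?thesis using exc by (intro exI[of _ "(i + 1, 0, 0, 1)"]) auto
  next
    case False
    \<comment> \<open>\<open>X1^d X4\<close> is not normal and becomes \<open>X2^(b+1)\<close> by
      \<open>rel2\<close>; the degree does not drop because \<open>d < b\<close>.\<close>
    then have "d = i + 1" using exc by simp
    then have "val (0, b + 1, 0, 0) = val x + n1" using exc rel2 by simp
    then show ?thesis using exc bounds by (intro exI[of _ "(0, b + 1, 0, 0)"]) auto
  qed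
qed

text \<open>The products to be rewritten contain \<open>X2^(b+1) X3\<close>, \<open>X2^(b+2)\<close>
  or \<open>X2 X4\<close>; they are handled by \<open>rel6\<close>, \<open>rel7\<close> and
  \<open>rel5\<close>.\<close>

lemma normal_form_add_n2:
  assumes "normal_form x"
  shows "\<exists>y. normal_form y \<and> val y = val x + n2 \<and> total_degree x < total_degree y"
  using assms
proof (cases rule: normal_form_cases)
  case (main i j l)
  show ?thesis
  proof (cases "j < b \<or> l = 0")
    case True
    then show ?thesis using main by (intro exI[of _ "(i, j + 1, l, 0)"]) auto
  next
    case False
    then obtain l' where "l = l' + 1" "j = b" using main by (cases l) auto
    then show ?thesis using main rel6 bounds
      by (intro exI[of _ "(i + (2 * d + 1 + p), 0, l', 0)"]) (auto simp: algebra_simps)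
  qed
next
  case (top i)
  then show ?thesis using rel7 bounds
    by (intro exI[of _ "(i + (2 * d + 1), 0, c, 0)"]) (auto simp: algebra_simps)
next
  case (exc i)
  then show ?thesis using rel5 bounds
    by (intro exI[of _ "(i + (d + 1), 0, c, 0)"]) (auto simp: algebra_simps)
qed

text \<open>\<open>X3^(c+1)\<close> becomes \<open>X1^p X2\<close> by \<open>rel3\<close>, where
  \<open>c \<le> p\<close> keeps the degree; \<open>X2^(b+1) X3\<close> and \<open>X3 X4\<close>
  become powers of \<open>X1\<close> by \<open>rel6\<close> and \<open>rel1\<close>.\<close>

lemma normal_form_add_n3:
  assumes "normal_form x"
  shows "\<exists>y. normal_form y \<and> val y = val x + n3 \<and> total_degree x < total_degree y"
  using assms
proof (cases rule: normal_form_cases)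
  case (main i j l)
  show ?thesis
  proof (cases "l < c")
    case True
    then show ?thesis using main by (intro exI[of _ "(i, j, l + 1, 0)"]) auto
  next
    case False
    then have "l = c" using main by simp
    then show ?thesis using main rel3 bounds
      by (intro exI[of _ "(i + p, j + 1, 0, 0)"]) (auto simp: algebra_simps)
  qed
next
  case (top i)
  then show ?thesis using rel6 bounds
    by (intro exI[of _ "(i + (2 * d + 1 + p), 0, 0, 0)"]) (auto simp: algebra_simps)
next
  case (exc i)
  then show ?thesis using rel1 bounds
    by (intro exI[of _ "(i + (d + 1 + p), 0, 0, 0)"]) (auto simp: algebra_simps)
qed

text \<open>Only \<open>X1^i X4\<close> with \<open>i < d\<close> stays as it is. The factors
  \<open>X3 X4\<close>, \<open>X2 X4\<close>, \<open>X1^d X4\<close> and \<open>X4^2\<close> are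
  replaced by \<open>rel1\<close>, \<open>rel5\<close>, \<open>rel2\<close> and
  \<open>rel4\<close>.\<close>

lemma normal_form_add_n4:
  assumes "normal_form x"
  shows "\<exists>y. normal_form y \<and> val y = val x + n4 \<and> total_degree x < total_degree y"
  using assms
proof (cases rule: normal_form_cases)
  case (main i j l)
  \<comment> \<open>Factors \<open>X3\<close> are treated first: once \<open>l = 0\<close>, the
    factor \<open>X3^c\<close> produced by \<open>rel5\<close> is admissible.\<close>
  consider "0 < l" | "0 < j" "l = 0" | "j = 0" "l = 0" "i < d" | "j = 0" "l = 0" "d \<le> i" by linarith
  then show ?thesis
  proof cases
    case 1
    then obtain l' where "l = l' + 1" by (cases l) auto
    then show ?thesis using main rel1 bounds
      by (intro exI[of _ "(i + (d + 1 + p), j, l', 0)"]) (auto simp: algebra_simps)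
  next
    case 2
    then obtain j' where "j = j' + 1" by (cases j) auto
    then show ?thesis using main 2 rel5 bounds
      by (intro exI[of _ "(i + (d + 1), j', c, 0)"]) (auto simp: algebra_simps)
  next
    case 3
    then show ?thesis using main by (intro exI[of _ "(i, 0, 0, 1)"]) auto
  next
    case 4
    then obtain i' where "i = i' + d" by (metis add.commute le_Suc_ex)
    then show ?thesis using main 4 rel2 bounds
      by (intro exI[of _ "(i', b + 1, 0, 0)"]) (auto simp: algebra_simps)
  qed
next
  case (top i)
  then show ?thesis using rel5 bounds
    by (intro exI[of _ "(i + (d + 1), b, c, 0)"]) (auto simp: algebra_simps)
next
  case (exc i)
  then show ?thesis using rel4 bounds
    by (intro exI[of _ "(i + 1, b, c, 0)"]) (auto simp: algebra_simps)
qed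

lemma normal_form_add_gen:
  assumes "normal_form x" "g \<in> {n1, n2, n3, n4}"
  shows "\<exists>y. normal_form y \<and> val y = val x + g \<and> total_degree x < total_degree y"
  using assms normal_form_add_n1 normal_form_add_n2 normal_form_add_n3 normal_form_add_n4
  by blast

section \<open>Uniqueness of normal forms\<close>

lemma coprime_n3_n1: "coprime n3 n1"
proof (rule coprimeI)
  fix q assume q: "q dvd n3" "q dvd n1"
  \<comment> \<open>A common divisor of \<open>n1\<close> and \<open>n3\<close> divides
    \<open>n2\<close> by \<open>rel3\<close>, then \<open>n4\<close> by \<open>rel2\<close>, and
    hence the gcd of all generators.\<close>
  have "q dvd p * n1 + n2" unfolding rel3[symmetric] using q by simp
  then have q2: "q dvd n2" using q by (simp add: dvd_add_right_iff)
  have "q dvd d * n1 + n4" unfolding rel2[symmetric] using q2 by simp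
  then have "q dvd n4" using q by (simp add: dvd_add_right_iff)
  then have "q dvd Gcd {n1, n2, n3, n4}" using q q2 by (intro Gcd_greatest) auto
  then show "is_unit q" unfolding gens_Gcd .
qed

lemma standard_val_inj:
  assumes eq: "i * n1 + j * n2 + l * n3 = i' * n1 + j' * n2 + l' * n3"
    and nf: "normal_form (i, j, l, 0)" "normal_form (i', j', l', 0)"
  shows "i = i'" "j = j'" "l = l'"
proof -
  \<comment> \<open>Modulo \<open>n1\<close> everything is a multiple of \<open>n3\<close>, and the multiplier encodes \<open>(j, l)\<close> in mixed radix.\<close>
  have n2_cong: "[n2 = (c + 1) * n3] (mod n1)"
    unfolding rel3 by (simp add: cong_def)
  have cong: "[i * n1 + j * n2 + l * n3 = (j * (c + 1) + l) * n3] (mod n1)" for i j l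
  proof -
    have "[i * n1 + j * n2 + l * n3 = 0 + j * ((c + 1) * n3) + l * n3] (mod n1)"
      by (intro cong_add cong_scalar_left n2_cong cong_refl) (simp add: cong_def)
    then show ?thesis by (simp add: algebra_simps)
  qed
  \<comment> \<open>The largest code is \<open>(b + 1) * (c + 1) = n1 - 1\<close>, attained by
    \<open>X2^(b+1)\<close>, so congruent codes are equal.\<close>
  have less: "j * (c + 1) + l < n1" if "normal_form (i, j, l, 0)" for i j l
  proof (cases "j \<le> b")
    case True
    then have "j * (c + 1) \<le> b * (c + 1)" by (rule mult_le_mono1)
    then show ?thesis using that unfolding n1_eq by simp
  qed (use that in \<open>simp add: n1_eq\<close>)
  have "[(j * (c + 1) + l) * n3 = (j' * (c + 1) + l') * n3] (mod n1)"
    using cong[of i j l] cong[of i' j' l'] eq by (metis cong_sym cong_trans)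
  then have "[j * (c + 1) + l = j' * (c + 1) + l'] (mod n1)"
    using cong_mult_rcancel_nat[OF coprime_n3_n1] by blast
  then have jl: "j * (c + 1) + l = j' * (c + 1) + l'"
    using less nf cong_less_modulus_unique_nat by blast
  moreover have "l < c + 1" "l' < c + 1" using nf by auto
  ultimately show "j = j'" "l = l'"
    by (metis add.commute add_cancel_right_left div_less div_mult_self3 less_nat_zero_code,
        metis add.commute mod_less mod_mult_self1)
  then show "i = i'" using eq gens_pos by simp
qed

lemma inj_on_val: "inj_on val {x. normal_form x}"
proof (rule inj_onI)
  \<comment> \<open>Adding \<open>d * n1\<close> turns the exceptional forms into ordinary ones, because \<open>X\<^sub>1\<^sup>d X\<^sub>4 = X\<^sub>2\<^bsup>b+1\<^esup>\<close>.\<close>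
  define std where "std = (\<lambda>(i, j :: nat, l :: nat, e :: nat). if e = 0 then (i + d, j, l) else (i, b + 1, 0))"
  have std: "normal_form (i, j, l, 0) \<and> i * n1 + j * n2 + l * n3 = val x + d * n1"
    if "normal_form x" "std x = (i, j, l)" for x i j l
    using that rel2 unfolding std_def
    by (cases x rule: normal_form_cases) (auto simp: algebra_simps)
  fix x y assume xy: "x \<in> {x. normal_form x}" "y \<in> {x. normal_form x}" "val x = val y"
  obtain i j l where x: "std x = (i, j, l)" by (rule prod_cases3)
  obtain i' j' l' where y: "std y = (i', j', l')" by (rule prod_cases3)
  have "std x = std y"
    using std[OF _ x] std[OF _ y] standard_val_inj[of i j l i' j' l'] xy x y by simp
  moreover have "normal_form x" "normal_form y" using xy by auto
  \<comment> \<open>The two kinds stay apart under \<open>std\<close>: the exponent of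
    \<open>X1\<close> is at least \<open>d\<close> for ordinary forms and below \<open>d\<close> for
    exceptional ones.\<close>
  ultimately show "x = y"
    unfolding std_def by (cases x; cases y) (auto split: if_splits)
qed

section \<open>Order as the degree of the normal form\<close>

sublocale positive_generators "{n1, n2, n3, n4}"
  by unfold_locales (use gens_pos in auto)

lemma order_ideal_add_multiple:
  assumes "s \<in> order_ideal {n1, n2, n3, n4} m" "g \<in> {n1, n2, n3, n4}"
  shows "s + k * g \<in> order_ideal {n1, n2, n3, n4} (m + k)"
proof (induction k)
  case (Suc k)
  then show ?case using assms(2) order_ideal_Suc_iff[of "s + Suc k * g" _ "m + k"]
    by (auto simp: add.left_commute)
qed (use assms in simp)

lemma val_in_order_ideal: "val x \<in> order_ideal {n1, n2, n3, n4} (total_degree x)"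
proof (cases x)
  case (fields i j l e)
  have "0 + i * n1 + j * n2 + l * n3 + e * n4 \<in> order_ideal {n1, n2, n3, n4} (0 + i + j + l + e)"
    using zero_in_semigroup by (intro order_ideal_add_multiple) auto
  then show ?thesis using fields by simp
qed

text \<open>Normal forms are built by adding one generator at a time. Since no addition lowers the
  degree, a factorization of length \<open>n\<close> leads to a normal form of degree at least
  \<open>n\<close>.\<close>

lemma order_ideal_eq_val: "order_ideal {n1, n2, n3, n4} n = val ` {x. normal_form x \<and> n \<le> total_degree x}"
proof
  show "val ` {x. normal_form x \<and> n \<le> total_degree x} \<subseteq> order_ideal {n1, n2, n3, n4} n"
    using val_in_order_ideal order_ideal_antimono by blast
  show "order_ideal {n1, n2, n3, n4} n \<subseteq> val ` {x. normal_form x \<and> n \<le> total_degree x}"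
  proof (induction n)
    case 0
    have "\<exists>x. normal_form x \<and> val x = s" if "s \<in> order_ideal {n1, n2, n3, n4} 0" for s
      using that
    proof (induction s rule: less_induct)
      case (less s)
      show ?case
      proof (cases "s = 0")
        case True
        then show ?thesis by (intro exI[of _ "(0, 0, 0, 0)"]) simp
      next
        case False
        then obtain g r where gr: "g \<in> {n1, n2, n3, n4}" "r \<in> order_ideal {n1, n2, n3, n4} 0" "s = g + r"
          using semigroup_cases[OF less.prems] unfolding One_nat_def order_ideal_Suc_iff by blast
        then have "r < s" using gens_pos by auto
        then obtain x where "normal_form x" "val x = r" using less.IH gr by blast
        then show ?thesis using normal_form_add_gen[of x g] gr by (auto simp: add.commute)
      qed
    qed
    then show ?case by (metis (mono_tags, lifting) imageI le0 mem_Collect_eq subsetI)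
  next
    case (Suc n)
    show ?case
    proof
      fix s assume "s \<in> order_ideal {n1, n2, n3, n4} (Suc n)"
      then obtain g r where gr: "g \<in> {n1, n2, n3, n4}" "r \<in> order_ideal {n1, n2, n3, n4} n" "s = g + r"
        unfolding order_ideal_Suc_iff by blast
      then obtain x where "normal_form x" "n \<le> total_degree x" "r = val x" using Suc by blast
      then obtain y where "normal_form y" "val y = s" "Suc n \<le> total_degree y"
        using normal_form_add_gen[of x g] gr by (metis Suc_le_eq add.commute order.strict_trans1)
      then show "s \<in> val ` {x. normal_form x \<and> Suc n \<le> total_degree x}" by blast
    qed
  qed
qed

text \<open>By uniqueness of normal forms the image commutes with the set difference, so the order
  of an element is the degree of its normal form.\<close>

lemma order_eq_val:
  "order_ideal {n1, n2, n3, n4} n - order_ideal {n1, n2, n3, n4} (Suc n) = val ` {x. normal_form x \<and> total_degree x = n}"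
proof -
  have "order_ideal {n1, n2, n3, n4} n - order_ideal {n1, n2, n3, n4} (Suc n)
      = val ` ({x. normal_form x \<and> n \<le> total_degree x} - {x. normal_form x \<and> Suc n \<le> total_degree x})"
    unfolding order_ideal_eq_val
    by (rule inj_on_image_set_diff[symmetric, OF inj_on_val]) auto
  also have "{x. normal_form x \<and> n \<le> total_degree x} - {x. normal_form x \<and> Suc n \<le> total_degree x} = {x. normal_form x \<and> total_degree x = n}"
    by auto
  finally show ?thesis .
qed

lemma inj_on_val_deg: "inj_on val {x. normal_form x \<and> total_degree x = n}"
  using inj_on_val by (rule inj_on_subset) auto

lemma card_order_mono:
  "card (order_ideal {n1, n2, n3, n4} n - order_ideal {n1, n2, n3, n4} (Suc n))
    \<le> card (order_ideal {n1, n2, n3, n4} (Suc n) - order_ideal {n1, n2, n3, n4} (Suc (Suc n)))"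
  unfolding order_eq_val card_image[OF inj_on_val_deg]
proof (rule card_inj_on_le)
  \<comment> \<open>The replacement \<open>X2^(d+1)\<close> is normal because \<open>d < b\<close>,
    and it has no factor \<open>X1\<close>, unlike every other image; this preserves
    injectivity.\<close>
  define next_form where "next_form = (\<lambda>(i, j, l, e :: nat).
    if e = 1 \<and> i + 1 = d then (0, d + 1, 0, 0) else (i + 1, j :: nat, l :: nat, e))"
  show "inj_on next_form {x. normal_form x \<and> total_degree x = n}"
    unfolding next_form_def inj_on_def by (auto split: if_splits)
  show "next_form ` {x. normal_form x \<and> total_degree x = n} \<subseteq> {x. normal_form x \<and> total_degree x = Suc n}"
    unfolding next_form_def using bounds by (auto split: if_splits)
  show "finite {x. normal_form x \<and> total_degree x = Suc n}"
    using finite_order[of "Suc n"] unfolding order_eq_val finite_image_iff[OF inj_on_val_deg] .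
qed

lemma hilbert_function_Suc_ge:
  "hilbert_function (semigroup_ring {n1, n2, n3, n4} :: 'k::field fps ring)
      (semigroup_ring_max_ideal {n1, n2, n3, n4}) n
    \<le> hilbert_function (semigroup_ring {n1, n2, n3, n4} :: 'k fps ring)
      (semigroup_ring_max_ideal {n1, n2, n3, n4}) (Suc n)"
  unfolding hilbert_function_semigroup_ring by (rule card_order_mono)

end


section \<open>Komeda's parameters\<close>

theorem theorem3p2:
  fixes n1 n2 n3 n4 :: nat
    and \<alpha>1 \<alpha>2 \<alpha>3 \<alpha>4 \<alpha>21 k :: int
  assumes pos: "0 < n1" "0 < n2" "0 < n3" "0 < n4"
    and gcd: "Gcd {n1, n2, n3, n4} = 1"
    and order: "n1 < n2" "n2 < n3" "n3 < n4"
    and four_generated: "minimally_generating {n1, n2, n3, n4}"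
    and pseudo_symmetric: "pseudo_symmetric (generated_semigroup {n1, n2, n3, n4})"
    and parameters: "\<alpha>1 > 1" "\<alpha>2 > 1" "\<alpha>3 > 1" "\<alpha>4 > 1" "0 < \<alpha>21" "\<alpha>21 < \<alpha>1 - 1"
    and n1: "int n1 = \<alpha>2 * \<alpha>3 * (\<alpha>4 - 1) + 1"
    and n2: "int n2 = \<alpha>21 * \<alpha>3 * \<alpha>4 + (\<alpha>1 - \<alpha>21 - 1) * (\<alpha>3 - 1) + \<alpha>3"
    and n3: "int n3 = \<alpha>1 * \<alpha>4 + (\<alpha>1 - \<alpha>21 - 1) * (\<alpha>2 - 1) * (\<alpha>4 - 1) - \<alpha>4 + 1"
    and n4: "int n4 = \<alpha>1 * \<alpha>2 * (\<alpha>3 - 1) + \<alpha>21 * (\<alpha>2 - 1) + \<alpha>2"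
    and \<alpha>2: "\<alpha>2 > \<alpha>21 + 1"
    and \<alpha>4: "\<alpha>4 = 2"
    and k_pos: "0 < k"
    and k: "k * (\<alpha>2 + 1) < (k - 1) * \<alpha>1 + (k + 1) * \<alpha>21 + \<alpha>3"
    and k_least: "\<And>j. 0 < j \<Longrightarrow> j * (\<alpha>2 + 1) < (j - 1) * \<alpha>1 + (j + 1) * \<alpha>21 + \<alpha>3 \<Longrightarrow> k \<le> j"
    and k_eq: "k = 1"
  shows "\<forall>n\<ge>1.
    hilbert_function (semigroup_ring {n1, n2, n3, n4} :: ('k::alg_closed_field) fps ring)
      (semigroup_ring_max_ideal {n1, n2, n3, n4}) n
    \<ge> hilbert_function (semigroup_ring {n1, n2, n3, n4} :: 'k fps ring)
      (semigroup_ring_max_ideal {n1, n2, n3, n4}) (n - 1)"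
proof -
  \<comment> \<open>The shifts remove all subtractions, so the relations become polynomial
    identities over the naturals.\<close>
  define b c d p where "b = nat (\<alpha>2 - 1)" "c = nat (\<alpha>3 - 1)" "d = nat \<alpha>21" "p = nat (\<alpha>1 - \<alpha>21 - 1)"
  then have \<alpha>: "\<alpha>2 = int b + 1" "\<alpha>3 = int c + 1" "\<alpha>21 = int d" "\<alpha>1 = int p + int d + 1"
    using parameters by auto
  have n1': "n1 = (b + 1) * (c + 1) + 1"
    using n1 unfolding \<alpha> \<alpha>4 by (simp flip: of_nat_eq_iff[where 'a = int] add: algebra_simps)
  have n2': "n2 = 2 * d * (c + 1) + p * c + c + 1"
    using n2 unfolding \<alpha> \<alpha>4 by (simp flip: of_nat_eq_iff[where 'a = int] add: algebra_simps)
  have n3': "n3 = 2 * d + 1 + 2 * p + p * b"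
    using n3 unfolding \<alpha> \<alpha>4 by (simp flip: of_nat_eq_iff[where 'a = int] add: algebra_simps)
  have n4': "n4 = (p + d + 1) * (b + 1) * c + d * b + b + 1"
    using n4 unfolding \<alpha> \<alpha>4 by (simp flip: of_nat_eq_iff[where 'a = int] add: algebra_simps)
  have rel3: "(c + 1) * n3 = p * n1 + n2"
    unfolding n1' n2' n3' by (simp add: algebra_simps)
  \<comment> \<open>The ordering of the generators enters through \<open>rel3\<close>:
    \<open>(c + 1) * n3 = p * n1 + n2 < (p + 1) * n2 < (p + 1) * n3\<close>, where the first strict
    step uses \<open>0 < p\<close>.\<close>
  have "c \<le> p"
  proof -
    have "0 < p" using parameters \<alpha> by simp
    then have "p * n1 + n2 < (p + 1) * n2" using order by simp
    also have "\<dots> < (p + 1) * n3" using order by (intro mult_less_mono2) auto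
    finally have "(c + 1) * n3 < (p + 1) * n3" unfolding rel3 .
    then show ?thesis by simp
  qed
  interpret pseudo_symmetric_relations n1 n2 n3 n4 b c d p
  proof
    show "(d + 1 + p) * n1 = n3 + n4"
      unfolding n1' n3' n4' by (simp add: algebra_simps)
    show "(b + 1) * n2 = d * n1 + n4"
      unfolding n1' n2' n4' by (simp add: algebra_simps)
    show "2 * n4 = n1 + b * n2 + c * n3"
      unfolding n1' n2' n3' n4' by (simp add: algebra_simps)
    show "(d + 1) * n1 + c * n3 = n2 + n4"
      unfolding n1' n2' n3' n4' by (simp add: algebra_simps)
    \<comment> \<open>\<open>d < b\<close> is the assumption \<alpha>2 > \<alpha>21 + 1, and the
      last bound is the inequality defining \<open>k\<close>, taken at \<open>k = 1\<close>.\<close>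
    show "0 < c" "0 < d" "d < b" "b + 1 < 2 * d + c"
      using parameters \<alpha>2 k k_eq unfolding \<alpha> by auto
  qed (fact n1' rel3 pos gcd \<open>c \<le> p\<close>)+
  show ?thesis
  proof (intro allI impI)
    fix n :: nat assume "1 \<le> n"
    then show "hilbert_function (semigroup_ring {n1, n2, n3, n4} :: 'k fps ring)
        (semigroup_ring_max_ideal {n1, n2, n3, n4}) n
      \<ge> hilbert_function (semigroup_ring {n1, n2, n3, n4} :: 'k fps ring)
        (semigroup_ring_max_ideal {n1, n2, n3, n4}) (n - 1)"
      using hilbert_function_Suc_ge[of "n - 1"] by simp
  qed
qed

end
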